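(* Let $n\ge 1$, let $\theta_1,\dots,\theta_n>0$ be pairwise distinct, and let $S_n\sim\mathrm{HypoXG}(\theta_1,\dots,\theta_n)$. Then, for every positive integer $m$, the moment of order $m$ of $S_n$ satisfies $$E[S_n^{m}]=\sum_{i=1}^{n}\sum_{k=1}^{3}R_{ik}\,E[Y_{ik}^{m}],$$ where $Y_{ik}\sim\mathrm{Erl}(4-k,\theta_i)$ and the $R_{ik}$ are the HypoXG coefficients associated with $(\theta_1,\dots,\theta_n)$.
   Context: XGamma distribution: for $\theta>0$, $X\sim \mathrm{XG}(\theta)$ means $X$ is a real random variable with density $\frac{\theta^2}{1+\theta}\left(1+\frac{\theta}{2}t^2\right)e^{-\theta t}$ for $t>0$, and $0$ otherwise. HypoXG: $S_n\sim\mathrm{HypoXG}(\theta_1,\dots,\theta_n)$ means $S_n=X_1+\cdots+X_n$ with $X_1,\dots,X_n$ independent and $X_j\sim\mathrm{XG}(\theta_j)$. Erlang distribution: for an integer $r\ge 1$ and $\theta>0$, $Y\sim\mathrm{Erl}(r,\theta)$ means $Y$ has density $\frac{(\theta t)^{r-1}\theta e^{-\theta t}}{(r-1)!}$ for $t\ge 0$ and $0$ for $t<0$. HypoXG coefficients: for pairwise distinct $\theta_1,\dots,\theta_n>0$, $1\le i\le n$, $1\le k\le 3$, $$R_{ik}=\frac{A_{ik}}{\theta_i^{4-k}}\prod_{l=1}^{n}\frac{\theta_l^{2}}{1+\theta_l},$$ where $$A_{i1}=\theta_i\prod_{j\ne i}\frac{(\theta_j-\theta_i)^2+\theta_j}{(\theta_j-\theta_i)^3},\qquad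 A_{i2}=A_{i1}\sum_{j\neq i}\left(\frac{2(\theta_j-\theta_i)}{(\theta_j-\theta_i)^2+\theta_j}-\frac{3}{\theta_j-\theta_i}\right),$$ $$A_{i3}=\frac{A_{i1}}{2}\left(\sum_{j\ne i}\left(\frac{2(\theta_j-\theta_i)}{(\theta_j-\theta_i)^2+\theta_j}-\frac{3}{\theta_j-\theta_i}\right)\right)^{2}+\frac{A_{i1}}{2}\left(\frac{2}{\theta_i}+\sum_{j\ne i}\left(-2\,\frac{(\theta_j-\theta_i)^2-\theta_j}{\left((\theta_j-\theta_i)^2+\theta_j\right)^2}+\frac{3}{(\theta_j-\theta_i)^2}\right)\right),$$ products and sums being over $j\in\{1,\dots,n\}\setminus\{i\}$ (empty product $=1$, empty sum $=0$). *)

theory Defs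
  imports "HOL-Probability.Probability"
begin

definition xgamma_density :: "real \<Rightarrow> real \<Rightarrow> real" where
  "xgamma_density \<theta> t =
     (if t > 0 then \<theta>^2 / (1 + \<theta>) * (1 + \<theta> / 2 * t^2) * exp (- \<theta> * t) else 0)"

definition XG :: "'a measure \<Rightarrow> real \<Rightarrow> ('a \<Rightarrow> real) \<Rightarrow> bool" where
  "XG M \<theta> X \<longleftrightarrow> prob_space M \<and> \<theta> > 0 \<and>
     distributed M lborel X (\<lambda>t. ennreal (xgamma_density \<theta> t))"

text \<open>The library's \<^const>\<open>erlang_density\<close> takes the exponent of the variable as its first
  argument, which is one less than the shape parameter \<open>r\<close>.\<close>

definition Erl :: "'a measure \<Rightarrow> nat \<Rightarrow> real \<Rightarrow> ('a \<Rightarrow> real) \<Rightarrow> bool" where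
  "Erl M r \<theta> Y \<longleftrightarrow> prob_space M \<and> r \<ge> 1 \<and> \<theta> > 0 \<and>
     distributed M lborel Y (\<lambda>t. ennreal (erlang_density (r - 1) \<theta> t))"

text \<open>The parameters are \<open>\<theta> 1, \<dots>, \<theta> n\<close>; values of \<open>\<theta>\<close> outside \<open>{1..n}\<close> are irrelevant,
  here and below.\<close>

definition HypoXG :: "'a measure \<Rightarrow> nat \<Rightarrow> (nat \<Rightarrow> real) \<Rightarrow> ('a \<Rightarrow> real) \<Rightarrow> bool" where
  "HypoXG M n \<theta> S \<longleftrightarrow> prob_space M \<and>
     (\<exists>X :: nat \<Rightarrow> 'a \<Rightarrow> real.
        prob_space.indep_vars M (\<lambda>_. borel) X {1..n} \<and>
        (\<forall>j\<in>{1..n}. XG M (\<theta> j) (X j)) \<and>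
        (\<forall>\<omega>\<in>space M. S \<omega> = (\<Sum>j=1..n. X j \<omega>)))"

definition hypoxg_A1 :: "nat \<Rightarrow> (nat \<Rightarrow> real) \<Rightarrow> nat \<Rightarrow> real" where
  "hypoxg_A1 n \<theta> i =
     \<theta> i * (\<Prod>j\<in>{1..n} - {i}. ((\<theta> j - \<theta> i)^2 + \<theta> j) / (\<theta> j - \<theta> i)^3)"

definition hypoxg_A2 :: "nat \<Rightarrow> (nat \<Rightarrow> real) \<Rightarrow> nat \<Rightarrow> real" where
  "hypoxg_A2 n \<theta> i =
     hypoxg_A1 n \<theta> i *
       (\<Sum>j\<in>{1..n} - {i}.
          2 * (\<theta> j - \<theta> i) / ((\<theta> j - \<theta> i)^2 + \<theta> j) - 3 / (\<theta> j - \<theta> i))"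

definition hypoxg_A3 :: "nat \<Rightarrow> (nat \<Rightarrow> real) \<Rightarrow> nat \<Rightarrow> real" where
  "hypoxg_A3 n \<theta> i =
     hypoxg_A1 n \<theta> i / 2 *
       (\<Sum>j\<in>{1..n} - {i}.
          2 * (\<theta> j - \<theta> i) / ((\<theta> j - \<theta> i)^2 + \<theta> j) - 3 / (\<theta> j - \<theta> i))^2 +
     hypoxg_A1 n \<theta> i / 2 *
       (2 / \<theta> i +
        (\<Sum>j\<in>{1..n} - {i}.
          - 2 * (((\<theta> j - \<theta> i)^2 - \<theta> j) / ((\<theta> j - \<theta> i)^2 + \<theta> j)^2) + 3 / (\<theta> j - \<theta> i)^2))"

text \<open>Only \<open>k \<in> {1, 2, 3}\<close> is meaningful.\<close>

definition hypoxg_A :: "nat \<Rightarrow> (nat \<Rightarrow> real) \<Rightarrow> nat \<Rightarrow> nat \<Rightarrow> real" where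
  "hypoxg_A n \<theta> i k =
     (if k = 1 then hypoxg_A1 n \<theta> i
      else if k = 2 then hypoxg_A2 n \<theta> i
      else hypoxg_A3 n \<theta> i)"

definition hypoxg_R :: "nat \<Rightarrow> (nat \<Rightarrow> real) \<Rightarrow> nat \<Rightarrow> nat \<Rightarrow> real" where
  "hypoxg_R n \<theta> i k =
     hypoxg_A n \<theta> i k / \<theta> i ^ (4 - k) * (\<Prod>l=1..n. (\<theta> l)^2 / (1 + \<theta> l))"

end

theory Submission
  imports
    Defs
    "HOL-Computational_Algebra.Field_as_Ring"
    "HOL-Computational_Algebra.Polynomial_Factorial"
    "HOL-Computational_Algebra.Polynomial_FPS"
begin

text \<open>
  Work with the exponential moment series \<open>\<Sum>m. E[X^m] x^m / m!\<close> as formal power series, so that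
  no convergence question arises: sums of independent variables become products, an
  \<open>Erl(r, \<theta>)\<close> variable has series \<open>(\<theta> / (\<theta> - x))^r\<close>, and an \<open>XG(\<theta>)\<close> variable has series
  \<open>\<theta>\<^sup>2 / (1 + \<theta>) * ((\<theta> - x)\<^sup>2 + \<theta>) / (\<theta> - x)^3\<close>. The \<open>A i k\<close> are the partial fraction
  coefficients of \<open>\<Prod>j. ((\<theta> j - x)\<^sup>2 + \<theta> j) / (\<theta> j - x)^3\<close>: after clearing denominators, both sides
  are polynomials of degree less than \<open>3 n\<close> which agree modulo each \<open>(\<theta> i - x)^3\<close>, as a second
  order expansion at \<open>x = \<theta> i\<close> shows.
\<close>

unbundle no vec_syntax
unbundle fps_syntax

subsection \<open>Second order expansions and divisibility\<close>

lemma fps_mult_nth_2: "(f * g) $ 2 = f $ 0 * g $ 2 + f $ 1 * g $ 1 + f $ 2 * g $ 0"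
  for f g :: "'a::semiring_0 fps"
  by (simp add: fps_mult_nth numeral_2_eq_2 add.assoc)

lemma fps_const_prod: "fps_const (\<Prod>i\<in>I. f i) = (\<Prod>i\<in>I. fps_const (f i))"
  for f :: "'i \<Rightarrow> 'a::comm_ring_1"
  by (induction I rule: infinite_finite_induct) (simp_all flip: fps_const_mult)

lemma fps_prod_nth_012:
  fixes f :: "'i \<Rightarrow> 'a::field_char_0 fps"
  assumes "finite I"
    and "\<And>j. j \<in> I \<Longrightarrow> f j $ 1 = f j $ 0 * L j"
    and "\<And>j. j \<in> I \<Longrightarrow> f j $ 2 = f j $ 0 / 2 * ((L j)^2 + K j)"
  shows "(\<Prod>j\<in>I. f j) $ 0 = (\<Prod>j\<in>I. f j $ 0)"
    and "(\<Prod>j\<in>I. f j) $ 1 = (\<Prod>j\<in>I. f j $ 0) * (\<Sum>j\<in>I. L j)"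
    and "(\<Prod>j\<in>I. f j) $ 2 = (\<Prod>j\<in>I. f j $ 0) / 2 * ((\<Sum>j\<in>I. L j)^2 + (\<Sum>j\<in>I. K j))"
proof -
  have "(\<Prod>j\<in>I. f j) $ 0 = (\<Prod>j\<in>I. f j $ 0) \<and>
    (\<Prod>j\<in>I. f j) $ 1 = (\<Prod>j\<in>I. f j $ 0) * (\<Sum>j\<in>I. L j) \<and>
    (\<Prod>j\<in>I. f j) $ 2 = (\<Prod>j\<in>I. f j $ 0) / 2 * ((\<Sum>j\<in>I. L j)^2 + (\<Sum>j\<in>I. K j))"
    using assms
  proof (induction I rule: finite_induct)
    case (insert i I)
    have IH: "(\<Prod>j\<in>I. f j) $ 0 = (\<Prod>j\<in>I. f j $ 0)"
        "(\<Prod>j\<in>I. f j) $ 1 = (\<Prod>j\<in>I. f j $ 0) * (\<Sum>j\<in>I. L j)"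
        "(\<Prod>j\<in>I. f j) $ 2 = (\<Prod>j\<in>I. f j $ 0) / 2 * ((\<Sum>j\<in>I. L j)^2 + (\<Sum>j\<in>I. K j))"
      using insert by auto
    have i: "f i $ 1 = f i $ 0 * L i" "f i $ 2 = f i $ 0 / 2 * ((L i)^2 + K i)"
      using insert.prems by auto
    show ?case
      unfolding prod.insert[OF insert.hyps] sum.insert[OF insert.hyps]
        fps_mult_nth_0 fps_mult_nth_1 fps_mult_nth_2 IH i
      by (simp add: field_simps power2_eq_square)
  qed simp
  then show "(\<Prod>j\<in>I. f j) $ 0 = (\<Prod>j\<in>I. f j $ 0)"
    and "(\<Prod>j\<in>I. f j) $ 1 = (\<Prod>j\<in>I. f j $ 0) * (\<Sum>j\<in>I. L j)"
    and "(\<Prod>j\<in>I. f j) $ 2 = (\<Prod>j\<in>I. f j $ 0) / 2 * ((\<Sum>j\<in>I. L j)^2 + (\<Sum>j\<in>I. K j))"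
    by blast+
qed

lemma xgamma_factor_nth_012:
  fixes d t :: real and g :: "real fps"
  assumes g: "g * (fps_const d + fps_X) ^ 3 = (fps_const d + fps_X) ^ 2 + fps_const t"
    and d: "d \<noteq> 0" and t: "d^2 + t \<noteq> 0"
  shows "g $ 0 = (d^2 + t) / d^3"
    and "g $ 1 = g $ 0 * (2 * d / (d^2 + t) - 3 / d)"
    and "g $ 2 = g $ 0 / 2 * ((2 * d / (d^2 + t) - 3 / d)^2
           + (- 2 * ((d^2 - t) / (d^2 + t)^2) + 3 / d^2))"
proof -
  let ?p = "fps_const d + fps_X"
  have p: "?p $ 0 = d" "?p $ 1 = 1" "?p $ 2 = 0"
    by (simp_all add: fps_X_def)
  have p2: "(?p^2) $ 0 = d^2" "(?p^2) $ 1 = 2 * d" "(?p^2) $ 2 = 1"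
    using p by (simp_all add: power2_eq_square fps_mult_nth_1 fps_mult_nth_2 del: One_nat_def)
  have eq: "?p ^ 3 = ?p^2 * ?p"
    by (simp add: power2_eq_square power3_eq_cube)
  have p3: "(?p^3) $ 0 = d^3" "(?p^3) $ 1 = 3 * d^2" "(?p^3) $ 2 = 3 * d"
    unfolding eq using p p2
    by (simp_all only: fps_mult_nth_0 fps_mult_nth_1 fps_mult_nth_2)
      (simp_all add: power2_eq_square power3_eq_cube)
  have e0: "g $ 0 * d^3 = d^2 + t"
    using arg_cong[OF g, of "\<lambda>f :: real fps. f $ 0"]
    by (simp only: fps_mult_nth_0 fps_add_nth p2 p3) simp
  have e1: "g $ 0 * (3 * d^2) + g $ 1 * d^3 = 2 * d"
    using arg_cong[OF g, of "\<lambda>f :: real fps. f $ 1"]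
    by (simp only: fps_mult_nth_1 fps_add_nth p2 p3) simp
  have e2: "g $ 0 * (3 * d) + g $ 1 * (3 * d^2) + g $ 2 * d^3 = 1"
    using arg_cong[OF g, of "\<lambda>f :: real fps. f $ 2"]
    by (simp only: fps_mult_nth_2 fps_add_nth p2 p3) simp
  show g0: "g $ 0 = (d^2 + t) / d^3"
    using e0 d by (simp add: field_simps)
  have g1: "g $ 1 = (2 * d - 3 * d^2 * g $ 0) / d^3"
    using e1 d by (simp add: field_simps)
  have g2: "g $ 2 = (1 - 3 * d * g $ 0 - 3 * d^2 * g $ 1) / d^3"
    using e2 d by (simp add: field_simps)
  define w where "w = d^2 + t"
  have w: "w \<noteq> 0" and wt: "d^2 + t = w" "d^2 - t = d^2 - (w - d^2)"
    using t by (auto simp: w_def)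
  show 1: "g $ 1 = g $ 0 * (2 * d / (d^2 + t) - 3 / d)"
    unfolding g1 g0 wt using d w by (simp add: field_simps power2_eq_square power3_eq_cube)
  show "g $ 2 = g $ 0 / 2 * ((2 * d / (d^2 + t) - 3 / d)^2
           + (- 2 * ((d^2 - t) / (d^2 + t)^2) + 3 / d^2))"
  proof -
    have "3 * d * (w / d^3) = 3 * (w / d^2)"
      using d by (simp add: power2_eq_square power3_eq_cube)
    moreover have "3 * d^2 * (w / d^3 * (2 * d / w - 3 / d)) = 6 - 9 * (w / d^2)"
      using d w by (simp add: right_diff_distrib power2_eq_square power3_eq_cube)
    ultimately have "(1 - 3 * d * (w / d^3) - 3 * d^2 * (w / d^3 * (2 * d / w - 3 / d))) / d^3
        = (6 * (w / d^2) - 5) / d^3"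
      by simp
    also have "\<dots> = w / d^3 / 2 * (12 / d^2 - 10 / w)"
      using d w by (simp add: right_diff_distrib diff_divide_distrib)
    also have "12 / d^2 - 10 / w =
        (2 * d / w - 3 / d)^2 + (- 2 * ((d^2 - (w - d^2)) / w^2) + 3 / d^2)"
    proof -
      have "(2 * d / w - 3 / d)^2 = 4 * (d^2 / w^2) - 12 / w + 9 / d^2"
        using d by (simp add: power2_diff power_divide power_mult_distrib)
      moreover have "- 2 * ((d^2 - (w - d^2)) / w^2) = 2 * (w / w^2) - 4 * (d^2 / w^2)"
        by (simp add: diff_divide_distrib)
      moreover have "w / w^2 = 1 / w" by (simp add: power2_eq_square)
      ultimately show ?thesis by simp
    qed
    finally have "(1 - 3 * d * (w / d^3) - 3 * d^2 * (w / d^3 * (2 * d / w - 3 / d))) / d^3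
        = w / d^3 / 2 * ((2 * d / w - 3 / d)^2 + (- 2 * ((d^2 - (w - d^2)) / w^2) + 3 / d^2))" .
    then show ?thesis
      unfolding g2 1 g0 wt .
  qed
qed

lemma poly_eq_0_of_coprime_dvd:
  fixes D :: "'a::field_gcd poly" and q :: "'i \<Rightarrow> 'a poly"
  assumes fin: "finite I"
    and dvd: "\<And>i. i \<in> I \<Longrightarrow> q i dvd D"
    and cop: "\<And>i j. i \<in> I \<Longrightarrow> j \<in> I \<Longrightarrow> i \<noteq> j \<Longrightarrow> coprime (q i) (q j)"
    and deg: "degree D < degree (\<Prod>i\<in>I. q i)"
  shows "D = 0"
proof -
  have "(\<Prod>i\<in>I. q i) dvd D"
    using fin dvd cop
  proof (induction I rule: finite_induct)
    case (insert i I)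
    then show ?case
      by (auto intro!: divides_mult prod_coprime_right)
  qed simp
  then show ?thesis
    using deg by (meson dvd_imp_degree_le linorder_not_less)
qed

lemma pcompose_power: "pcompose (p ^ n) q = pcompose p q ^ n"
  for p q :: "'a::comm_ring_1 poly"
  by (induction n) (simp_all add: pcompose_mult pcompose_1)

lemma linear_power_dvd_iff:
  fixes p :: "'a::idom poly"
  shows "[:a, -1:] ^ n dvd p \<longleftrightarrow> (\<forall>k<n. coeff (pcompose p [:a, -1:]) k = 0)"
proof -
  have inv: "pcompose (pcompose q [:a, -1:]) [:a, -1:] = q" for q :: "'a poly"
    by (simp add: pcompose_assoc[symmetric] pcompose_pCons pcompose_idR)
  have X: "monom 1 n = ([:0, 1:] :: 'a poly) ^ n"
    by (simp add: monom_altdef)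
  have "[:a, -1:] ^ n dvd p \<longleftrightarrow> monom 1 n dvd pcompose p [:a, -1:]"
  proof
    assume "[:a, -1:] ^ n dvd p"
    then obtain q where "p = [:a, -1:] ^ n * q" ..
    then show "monom 1 n dvd pcompose p [:a, -1:]"
      by (simp add: X pcompose_mult pcompose_power pcompose_pCons)
  next
    assume "monom 1 n dvd pcompose p [:a, -1:]"
    then obtain q where "pcompose p [:a, -1:] = [:0, 1:] ^ n * q"
      unfolding X ..
    then have "p = [:a, -1:] ^ n * pcompose q [:a, -1:]"
      using inv[of p] by (simp add: pcompose_mult pcompose_power pcompose_pCons)
    then show "[:a, -1:] ^ n dvd p" by simp
  qed
  then show ?thesis by (simp add: monom_1_dvd_iff')
qed

subsection \<open>Moment series\<close>

definition moment_fps :: "'a measure \<Rightarrow> ('a \<Rightarrow> real) \<Rightarrow> real fps" where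
  "moment_fps M X = Abs_fps (\<lambda>m. (\<integral>x. X x ^ m \<partial>M) / fact m)"

lemma moment_fps_nth [simp]: "moment_fps M X $ m = (\<integral>x. X x ^ m \<partial>M) / fact m"
  by (simp add: moment_fps_def)

definition erlang_fps :: "nat \<Rightarrow> real \<Rightarrow> real fps" where
  "erlang_fps k l = Abs_fps (\<lambda>m. fact (k + m) / (fact k * l ^ m) / fact m)"

lemma erlang_fps_nth [simp]: "erlang_fps k l $ m = fact (k + m) / (fact k * l ^ m) / fact m"
  by (simp add: erlang_fps_def)

lemma fps_mult_const_minus_X_nth:
  fixes f :: "'a::comm_ring_1 fps"
  shows "(f * (fps_const l - fps_X)) $ m = f $ m * l - (if m = 0 then 0 else f $ (m - 1))"
  by (simp add: right_diff_distrib)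

lemma erlang_fps_0_mult:
  assumes l: "l > 0"
  shows "erlang_fps 0 l * (fps_const l - fps_X) = fps_const l"
proof (rule fps_ext)
  fix m
  show "(erlang_fps 0 l * (fps_const l - fps_X)) $ m = fps_const l $ m"
    unfolding fps_mult_const_minus_X_nth erlang_fps_nth using l by (cases m) auto
qed

lemma erlang_fps_Suc_mult:
  assumes l: "l > 0"
  shows "erlang_fps (Suc k) l * (fps_const l - fps_X) = fps_const l * erlang_fps k l"
proof (rule fps_ext)
  fix m
  show "(erlang_fps (Suc k) l * (fps_const l - fps_X)) $ m = (fps_const l * erlang_fps k l) $ m"
  proof (cases m)
    case 0
    then show ?thesis
      unfolding fps_mult_const_minus_X_nth by simp
  next
    case (Suc r)
    define F :: real where "F = fact (k + Suc r)"
    have facts: "(fact (Suc k + Suc r) :: real) = (real k + 1 + real r + 1) * F"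
        "(fact (Suc k + r) :: real) = F" "(fact (k + Suc r) :: real) = F"
        "(fact (Suc k) :: real) = (real k + 1) * fact k"
        "(fact (Suc r) :: real) = (real r + 1) * fact r"
      unfolding F_def by (simp_all add: algebra_simps)
    have "(real k + 1 + real r + 1) * F / ((real k + 1) * a * (l * p)) / ((real r + 1) * b) * l
        - F / ((real k + 1) * a * p) / b = l * (F / (a * (l * p)) / ((real r + 1) * b))"
      if "a > 0" "b > 0" "p > 0" for a b p :: real
    proof -
      have nz: "real k + 1 \<noteq> 0" "real r + 1 \<noteq> 0" by (metis of_nat_Suc of_nat_neq_0 add.commute)+
      have "(real k + 1 + real r + 1) * F / ((real k + 1) * a * (l * p)) / ((real r + 1) * b) * l
          = (real k + 1 + (real r + 1)) * F / ((real k + 1) * a * p * ((real r + 1) * b))"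
        using that l by simp
      also have "\<dots> - F / ((real k + 1) * a * p) / b = F / (a * p * ((real r + 1) * b))"
        using nz that by (simp add: divide_simps) (simp add: algebra_simps)
      also have "\<dots> = l * (F / (a * (l * p)) / ((real r + 1) * b))"
        using that l by simp
      finally show ?thesis .
    qed
    from this[of "fact k" "fact r" "l ^ r"] l show ?thesis
      unfolding Suc fps_mult_const_minus_X_nth erlang_fps_nth fps_mult_left_const_nth
      by (simp only: diff_Suc_1 facts power_Suc if_False nat.distinct) simp
  qed
qed

lemma erlang_fps_mult_power:
  assumes l: "l > 0"
  shows "erlang_fps k l * (fps_const l - fps_X) ^ Suc k = fps_const (l ^ Suc k)"
proof (induction k)
  case 0
  show ?case using erlang_fps_0_mult[OF l] by simp
next
  case (Suc k)
  have "erlang_fps (Suc k) l * (fps_const l - fps_X) ^ Suc (Suc k) =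
      (erlang_fps (Suc k) l * (fps_const l - fps_X)) * (fps_const l - fps_X) ^ Suc k"
    unfolding power_Suc[of _ "Suc k"] by (rule mult.assoc[symmetric])
  also have "\<dots> = fps_const l * (erlang_fps k l * (fps_const l - fps_X) ^ Suc k)"
    unfolding erlang_fps_Suc_mult[OF l] by (rule mult.assoc)
  also have "\<dots> = fps_const (l ^ Suc (Suc k))"
    unfolding Suc.IH by simp
  finally show ?case .
qed

lemma has_bochner_integral_xgamma_moment:
  assumes l: "l > 0"
  shows "has_bochner_integral lborel (\<lambda>t. xgamma_density l t * t ^ m)
    (l^2 / (1 + l) * (fact m / l ^ m / l + fact (2 + m) / (fact 2 * l ^ m) / l^2))"
proof -
  have e: "has_bochner_integral lborel (\<lambda>t. erlang_density k l t * t ^ m)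
      (fact (k + m) / (fact k * l ^ m))" for k
  proof (rule has_bochner_integral_nn_integral)
    show "(\<integral>\<^sup>+ t. ennreal (erlang_density k l t * t ^ m) \<partial>lborel) = ennreal (fact (k + m) / (fact k * l ^ m))"
      by (rule nn_integral_erlang_ith_moment[OF l])
    show "AE t in lborel. 0 \<le> erlang_density k l t * t ^ m"
      using l by (auto simp: erlang_density_def)
  qed (use l in auto)
  have "has_bochner_integral lborel
      (\<lambda>t. l^2 / (1 + l) * (erlang_density 0 l t * t ^ m / l + erlang_density 2 l t * t ^ m / l^2))
      (l^2 / (1 + l) * (fact m / l ^ m / l + fact (2 + m) / (fact 2 * l ^ m) / l^2))"
    using has_bochner_integral_add[OF has_bochner_integral_divide[OF e[of 0], of l]
        has_bochner_integral_divide[OF e[of 2], of "l^2"]]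
    by (intro has_bochner_integral_mult_right) simp
  then show ?thesis
  proof (rule has_bochner_integral_cong_AE[THEN iffD1, rotated -1])
    show "AE t in lborel. l^2 / (1 + l) *
        (erlang_density 0 l t * t ^ m / l + erlang_density 2 l t * t ^ m / l^2) =
        xgamma_density l t * t ^ m"
      using AE_lborel_singleton[of 0]
    proof eventually_elim
      case (elim t)
      show ?case
      proof (cases "t > 0")
        case True
        have e0: "erlang_density 0 l t * t ^ m / l = exp (- l * t) * t ^ m"
          using True l by (simp add: erlang_density_def)
        have e2: "erlang_density 2 l t * t ^ m / l^2 = l / 2 * t^2 * exp (- l * t) * t ^ m"
          using True l by (simp add: erlang_density_def power2_eq_square power3_eq_cube
              fact_numeral eval_nat_numeral)
        have "e * p + a * e * p = (1 + a) * (e * p)" for a e p :: real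
          by (simp add: algebra_simps)
        from this[of "exp (- l * t)" "t ^ m" "l / 2 * t^2"] show ?thesis
          unfolding e0 e2 xgamma_density_def using True by simp
      next
        case False
        then show ?thesis
          using elim by (simp add: xgamma_density_def erlang_density_def)
      qed
    qed
  qed (auto simp: xgamma_density_def)
qed

lemma XG_moment:
  assumes "XG M l X"
  shows "integrable M (\<lambda>x. X x ^ m)"
    and "moment_fps M X * (fps_const l - fps_X) ^ 3 =
      fps_const (l^2 / (1 + l)) * ((fps_const l - fps_X) ^ 2 + fps_const l)"
proof -
  from assms have l: "l > 0" and D: "distributed M lborel X (\<lambda>t. ennreal (xgamma_density l t))"
    by (auto simp: XG_def)
  have nonneg: "xgamma_density l t \<ge> 0" for t
    using l by (simp add: xgamma_density_def)
  show "integrable M (\<lambda>x. X x ^ m)"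
    using distributed_integrable[OF D, of "\<lambda>t. t ^ m"] nonneg
      has_bochner_integral_xgamma_moment[OF l, of m]
    by (simp add: has_bochner_integral_iff)
  have E: "(\<integral>x. X x ^ m \<partial>M) =
      l^2 / (1 + l) * (fact m / l ^ m / l + fact (2 + m) / (fact 2 * l ^ m) / l^2)" for m
    using distributed_integral[OF D, of "\<lambda>t. t ^ m"] nonneg
      has_bochner_integral_xgamma_moment[OF l, of m]
    by (simp add: has_bochner_integral_iff)
  let ?P = "fps_const l - fps_X"
  have F: "moment_fps M X = fps_const (l^2 / (1 + l)) *
      (fps_const (1 / l) * erlang_fps 0 l + fps_const (1 / l^2) * erlang_fps 2 l)"
  proof (rule fps_ext)
    have alg: "c * (a / p / l + b / (q * p) / r) / F =
        c * (1 / l * (a / (1 * p) / F) + 1 / r * (b / (q * p) / F))" for a b c p q r F :: real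
      by (simp add: add_divide_distrib distrib_left mult_ac)
    show "moment_fps M X $ m = (fps_const (l^2 / (1 + l)) *
        (fps_const (1 / l) * erlang_fps 0 l + fps_const (1 / l^2) * erlang_fps 2 l)) $ m" for m
      by (simp only: moment_fps_nth E fps_mult_left_const_nth fps_add_nth erlang_fps_nth alg
          fact_0 add_0)
  qed
  have "moment_fps M X * ?P ^ 3 = fps_const (l^2 / (1 + l)) *
      (fps_const (1 / l) * (erlang_fps 0 l * ?P ^ Suc 0) * ?P^2
        + fps_const (1 / l^2) * (erlang_fps 2 l * ?P ^ Suc 2))"
  proof -
    have "(c * (a * e + b * g)) * p ^ 3 = c * (a * (e * p ^ Suc 0) * p^2 + b * (g * p ^ Suc 2))"
      for a b c e g p :: "real fps"
      by (simp add: algebra_simps power2_eq_square power3_eq_cube)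
    then show ?thesis unfolding F .
  qed
  also have "\<dots> = fps_const (l^2 / (1 + l)) *
      (fps_const (1 / l * l) * ?P^2 + fps_const (1 / l^2 * l^3))"
    unfolding erlang_fps_mult_power[OF l] by simp
  also have "1 / l * l = 1" using l by simp
  also have "1 / l^2 * l^3 = l" using l by (simp add: power2_eq_square power3_eq_cube)
  finally show "moment_fps M X * ?P ^ 3 = fps_const (l^2 / (1 + l)) * (?P ^ 2 + fps_const l)"
    by simp
qed

lemma Erl_moment:
  assumes "Erl M r l Y"
  shows "integrable M (\<lambda>x. Y x ^ m)"
    and "moment_fps M Y = erlang_fps (r - 1) l"
proof -
  from assms interpret prob_space M by (simp add: Erl_def)
  from assms have l: "l > 0" and D: "distributed M lborel Y (erlang_density (r - 1) l)"
    by (simp_all add: Erl_def)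
  show "integrable M (\<lambda>x. Y x ^ m)"
    by (rule erlang_ith_moment_integrable[OF l D])
  show "moment_fps M Y = erlang_fps (r - 1) l"
    by (rule fps_ext) (simp add: erlang_ith_moment[OF l D])
qed

context prob_space begin

lemma indep_var_power_integral:
  fixes X Y :: "'a \<Rightarrow> real"
  assumes "indep_var borel X borel Y"
    and "integrable M (\<lambda>x. X x ^ i)" "integrable M (\<lambda>x. Y x ^ j)"
  shows "integrable M (\<lambda>x. X x ^ i * Y x ^ j)"
    and "(\<integral>x. X x ^ i * Y x ^ j \<partial>M) = (\<integral>x. X x ^ i \<partial>M) * (\<integral>x. Y x ^ j \<partial>M)"
proof -
  have "indep_var borel (\<lambda>x. X x ^ i) borel (\<lambda>x. Y x ^ j)"
    using indep_var_compose[OF assms(1), of "\<lambda>t. t ^ i" borel "\<lambda>t. t ^ j" borel]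
    by (simp add: comp_def)
  from indep_var_integrable[OF this assms(2,3)] indep_var_lebesgue_integral[OF this assms(2,3)]
  show "integrable M (\<lambda>x. X x ^ i * Y x ^ j)"
    and "(\<integral>x. X x ^ i * Y x ^ j \<partial>M) = (\<integral>x. X x ^ i \<partial>M) * (\<integral>x. Y x ^ j \<partial>M)" by auto
qed

lemma indep_var_add_moment:
  fixes X Y :: "'a \<Rightarrow> real"
  assumes ind: "indep_var borel X borel Y"
    and X: "\<And>m. integrable M (\<lambda>x. X x ^ m)" and Y: "\<And>m. integrable M (\<lambda>x. Y x ^ m)"
  shows "integrable M (\<lambda>x. (X x + Y x) ^ m)"
    and "moment_fps M (\<lambda>x. X x + Y x) = moment_fps M X * moment_fps M Y"
proof -
  note I = indep_var_power_integral[OF ind X Y]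
  show "integrable M (\<lambda>x. (X x + Y x) ^ m)"
    unfolding binomial_ring mult.assoc by (auto intro!: Bochner_Integration.integrable_sum integrable_mult_right I(1))
  have "(\<integral>x. (X x + Y x) ^ m \<partial>M) =
      (\<Sum>k\<le>m. of_nat (m choose k) * ((\<integral>x. X x ^ k \<partial>M) * (\<integral>x. Y x ^ (m - k) \<partial>M)))" for m
    unfolding binomial_ring mult.assoc using I
    by (subst Bochner_Integration.integral_sum) auto
  then show "moment_fps M (\<lambda>x. X x + Y x) = moment_fps M X * moment_fps M Y"
    by (intro fps_ext)
      (auto simp: fps_mult_nth sum_divide_distrib binomial_fact atLeast0AtMost intro!: sum.cong)
qed

lemma indep_vars_sum_moment:
  fixes X :: "'i \<Rightarrow> 'a \<Rightarrow> real"
  assumes "finite I" and "indep_vars (\<lambda>_. borel) X I"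
    and "\<And>i m. i \<in> I \<Longrightarrow> integrable M (\<lambda>x. X i x ^ m)"
  shows "(\<forall>m. integrable M (\<lambda>x. (\<Sum>i\<in>I. X i x) ^ m)) \<and>
    moment_fps M (\<lambda>x. \<Sum>i\<in>I. X i x) = (\<Prod>i\<in>I. moment_fps M (X i))"
  using assms
proof (induction I rule: finite_induct)
  case empty
  show ?case
  proof (intro conjI allI)
    fix m show "integrable M (\<lambda>x. (\<Sum>i\<in>{}. X i x) ^ m)" by simp
    show "moment_fps M (\<lambda>x. \<Sum>i\<in>{}. X i x) = (\<Prod>i\<in>{}. moment_fps M (X i))"
      by (rule fps_ext) (simp add: power_0_left prob_space)
  qed
next
  case (insert i I)
  have "indep_vars (\<lambda>_. borel) X I"
    using insert.prems(1) by (rule indep_vars_subset) auto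
  then have IH: "integrable M (\<lambda>x. (\<Sum>i\<in>I. X i x) ^ m)"
      "moment_fps M (\<lambda>x. \<Sum>i\<in>I. X i x) = (\<Prod>i\<in>I. moment_fps M (X i))" for m
    using insert by auto
  have "indep_var borel (X i) borel (\<lambda>x. \<Sum>i\<in>I. X i x)"
    using insert by (intro indep_vars_sum) auto
  from indep_var_add_moment[OF this insert.prems(2) IH(1)] show ?case
    using insert.hyps by (simp add: IH(2))
qed

end

subsection \<open>Partial fractions\<close>

lemma fps_mult_nth_eq_0_below_3:
  fixes f g :: "'a::semiring_0 fps"
  assumes "f $ 0 = 0" "f $ 1 = 0" "f $ 2 = 0" "k < 3"
  shows "(f * g) $ k = 0"
proof -
  have "f $ i = 0" if "i \<le> k" for i
  proof -
    have "i \<in> {0, 1, 2}" using that assms(4) by auto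
    then show ?thesis using assms by auto
  qed
  then show ?thesis by (auto simp: fps_mult_nth intro!: sum.neutral)
qed

lemma hypoxg_expansion:
  fixes \<theta> :: "nat \<Rightarrow> real"
  assumes pos: "\<And>j. j \<in> {1..n} \<Longrightarrow> \<theta> j > 0"
    and inj: "inj_on \<theta> {1..n}" and i: "i \<in> {1..n}"
  defines "V \<equiv> \<lambda>j. fps_const (\<theta> j - \<theta> i) + fps_X"
  assumes k: "k < 3"
  shows "((\<Prod>j\<in>{1..n}. (V j)^2 + fps_const (\<theta> j)) -
      (fps_const (hypoxg_A n \<theta> i 1) + fps_const (hypoxg_A n \<theta> i 2) * V i
        + fps_const (hypoxg_A n \<theta> i 3) * (V i)^2) * (\<Prod>j\<in>{1..n} - {i}. (V j)^3)) $ k = 0"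
proof -
  define I where "I = {1..n} - {i}"
  define g where "g j = ((V j)^2 + fps_const (\<theta> j)) * inverse ((V j)^3)" for j
  define d where "d j = \<theta> j - \<theta> i" for j
  define L where "L j = 2 * d j / ((d j)^2 + \<theta> j) - 3 / d j" for j
  define K where "K j = - 2 * (((d j)^2 - \<theta> j) / ((d j)^2 + \<theta> j)^2) + 3 / (d j)^2" for j
  define G where "G = (\<Prod>j\<in>I. g j)"
  define W where "W = (\<Prod>j\<in>I. (V j)^3)"
  define T where "T = fps_const (hypoxg_A n \<theta> i 1) + fps_const (hypoxg_A n \<theta> i 2) * V i
        + fps_const (hypoxg_A n \<theta> i 3) * (V i)^2"
  have fin: "finite I" by (simp add: I_def)
  have d0: "d j \<noteq> 0" if "j \<in> I" for j
    using that inj_onD[OF inj, of j i] i unfolding I_def d_def by auto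
  have t0: "(d j)^2 + \<theta> j \<noteq> 0" if "j \<in> I" for j
  proof -
    have "\<theta> j > 0" using that pos by (simp add: I_def)
    then show ?thesis using zero_le_power2[of "d j"] by linarith
  qed
  have gV: "g j * (V j)^3 = (V j)^2 + fps_const (\<theta> j)" if "j \<in> I" for j
  proof -
    have "((V j)^3) $ 0 \<noteq> 0"
      using d0[OF that] by (simp add: V_def d_def fps_power_zeroth)
    then have "inverse ((V j)^3) * (V j)^3 = 1" by (rule inverse_mult_eq_1)
    then show ?thesis unfolding g_def mult.assoc by (simp only: mult_1_right)
  qed
  note ex = xgamma_factor_nth_012[OF gV[unfolded V_def, folded d_def] d0 t0]
  have g0: "g j $ 0 = ((d j)^2 + \<theta> j) / (d j)^3" and g1: "g j $ 1 = g j $ 0 * L j"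
    and g2: "g j $ 2 = g j $ 0 / 2 * ((L j)^2 + K j)" if "j \<in> I" for j
    unfolding L_def K_def by (rule ex[OF that that that])+
  define p where "p = (\<Prod>j\<in>I. ((d j)^2 + \<theta> j) / (d j)^3)"
  have p: "(\<Prod>j\<in>I. g j $ 0) = p"
    unfolding p_def by (intro prod.cong refl g0)
  have G: "G $ 0 = p" "G $ 1 = p * (\<Sum>j\<in>I. L j)"
      "G $ 2 = p / 2 * ((\<Sum>j\<in>I. L j)^2 + (\<Sum>j\<in>I. K j))"
    unfolding G_def p[symmetric] by (rule fps_prod_nth_012[OF fin g1 g2]; assumption)+
  have A1: "hypoxg_A n \<theta> i 1 = \<theta> i * p"
    unfolding hypoxg_A_def hypoxg_A1_def p_def I_def d_def by simp
  have A2: "hypoxg_A n \<theta> i 2 = \<theta> i * p * (\<Sum>j\<in>I. L j)"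
    unfolding hypoxg_A_def hypoxg_A1_def hypoxg_A2_def p_def I_def d_def L_def by simp
  have "hypoxg_A n \<theta> i 3 = \<theta> i * p / 2 * (\<Sum>j\<in>I. L j)^2 + \<theta> i * p / 2 * (2 / \<theta> i + (\<Sum>j\<in>I. K j))"
    unfolding hypoxg_A_def hypoxg_A1_def hypoxg_A3_def p_def I_def d_def L_def K_def by simp
  then have A3: "hypoxg_A n \<theta> i 3 = \<theta> i * (p / 2 * ((\<Sum>j\<in>I. L j)^2 + (\<Sum>j\<in>I. K j))) + p"
    using pos[OF i] by (simp add: distrib_left)
  have Vi: "V i = fps_X" by (simp add: V_def)
  have X: "(fps_X :: real fps) $ 0 = 0" "(fps_X :: real fps) $ 1 = 1" "(fps_X :: real fps) $ 2 = 0"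
    "((fps_X :: real fps)^2) $ 0 = 0" "((fps_X :: real fps)^2) $ 1 = 0" "((fps_X :: real fps)^2) $ 2 = 1"
    by (simp_all add: fps_X_power_nth)
  have c: "fps_const a $ 0 = a" "fps_const a $ 1 = 0" "fps_const a $ 2 = 0" for a :: real
    by simp_all
  let ?B = "(fps_X^2 + fps_const (\<theta> i)) * G - T"
  have "?B $ 0 = 0" "?B $ 1 = 0" "?B $ 2 = 0"
    unfolding T_def Vi fps_sub_nth fps_add_nth fps_mult_nth_0 fps_mult_nth_1 fps_mult_nth_2 X c G A1 A2 A3
    by simp_all
  then have "(?B * W) $ k = 0"
    using k by (rule fps_mult_nth_eq_0_below_3)
  moreover have "?B * W = (\<Prod>j\<in>{1..n}. (V j)^2 + fps_const (\<theta> j)) - T * W"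
  proof -
    have "(\<Prod>j\<in>{1..n}. (V j)^2 + fps_const (\<theta> j)) =
        (fps_X^2 + fps_const (\<theta> i)) * (\<Prod>j\<in>I. (V j)^2 + fps_const (\<theta> j))"
      using i by (subst prod.remove[of _ i]) (simp_all add: I_def Vi)
    also have "(\<Prod>j\<in>I. (V j)^2 + fps_const (\<theta> j)) = G * W"
      unfolding G_def W_def prod.distrib[symmetric] using gV by simp
    finally show ?thesis by (simp add: left_diff_distrib mult.assoc)
  qed
  ultimately show ?thesis unfolding T_def W_def I_def by simp
qed

lemma hypoxg_partial_fractions_poly:
  fixes \<theta> :: "nat \<Rightarrow> real"
  assumes n: "n \<ge> 1" and pos: "\<And>j. j \<in> {1..n} \<Longrightarrow> \<theta> j > 0"
    and inj: "inj_on \<theta> {1..n}"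
  defines "P \<equiv> \<lambda>j. [:\<theta> j, -1:]"
  shows "(\<Prod>j\<in>{1..n}. (P j)^2 + [:\<theta> j:]) =
    (\<Sum>i\<in>{1..n}. ([:hypoxg_A n \<theta> i 1:] + [:hypoxg_A n \<theta> i 2:] * P i
        + [:hypoxg_A n \<theta> i 3:] * (P i)^2) * (\<Prod>j\<in>{1..n} - {i}. (P j)^3))"
proof -
  define T where "T i = [:hypoxg_A n \<theta> i 1:] + [:hypoxg_A n \<theta> i 2:] * P i
        + [:hypoxg_A n \<theta> i 3:] * (P i)^2" for i
  define D where "D = (\<Prod>j\<in>{1..n}. (P j)^2 + [:\<theta> j:]) -
    (\<Sum>i\<in>{1..n}. T i * (\<Prod>j\<in>{1..n} - {i}. (P j)^3))"
  have degP: "degree (P j ^ k) = k" for j k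
    by (simp add: P_def degree_power_eq)
  have "D = 0"
  proof (rule poly_eq_0_of_coprime_dvd)
    show "finite {1..n}" by simp
    show "P i ^ 3 dvd D" if i: "i \<in> {1..n}" for i
      unfolding P_def linear_power_dvd_iff
    proof (intro allI impI)
      fix k :: nat assume k: "k < 3"
      define V where "V j = fps_const (\<theta> j - \<theta> i) + fps_X" for j
      have PV: "fps_of_poly (pcompose (P j) [:\<theta> i, -1:]) = V j" for j
        by (simp add: P_def V_def pcompose_pCons fps_of_poly_pCons)
      have TV: "fps_of_poly (pcompose (T l) [:\<theta> i, -1:]) =
          fps_const (hypoxg_A n \<theta> l 1) + fps_const (hypoxg_A n \<theta> l 2) * V l
          + fps_const (hypoxg_A n \<theta> l 3) * (V l)^2" for l
        by (simp only: T_def pcompose_add pcompose_mult pcompose_power pcompose_const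
            fps_of_poly_add fps_of_poly_mult fps_of_poly_power fps_of_poly_const PV)
      define U where "U l = fps_of_poly (pcompose (T l) [:\<theta> i, -1:]) * (\<Prod>j\<in>{1..n} - {l}. (V j)^3)" for l
      have "fps_of_poly (pcompose D [:\<theta> i, -1:]) =
          (\<Prod>j\<in>{1..n}. (V j)^2 + fps_const (\<theta> j)) - (\<Sum>l\<in>{1..n}. U l)"
        unfolding D_def U_def
        by (simp only: pcompose_diff pcompose_sum pcompose_prod pcompose_add pcompose_mult
            pcompose_power pcompose_const fps_of_poly_diff fps_of_poly_sum fps_of_poly_prod
            fps_of_poly_add fps_of_poly_mult fps_of_poly_power fps_of_poly_const PV)
      also have "(\<Sum>l\<in>{1..n}. U l) = U i + (\<Sum>l\<in>{1..n} - {i}. U l)"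
        using i by (intro sum.remove) auto
      finally have D: "fps_of_poly (pcompose D [:\<theta> i, -1:]) =
          ((\<Prod>j\<in>{1..n}. (V j)^2 + fps_const (\<theta> j)) - U i) - (\<Sum>l\<in>{1..n} - {i}. U l)"
        by simp
      have "U l $ k = 0" if l: "l \<in> {1..n} - {i}" for l
      proof -
        have "(\<Prod>j\<in>{1..n} - {l}. (V j)^3) = (V i)^3 * (\<Prod>j\<in>{1..n} - {l} - {i}. (V j)^3)"
          using i l by (intro prod.remove) auto
        then have "U l = fps_X ^ 3 * (fps_of_poly (pcompose (T l) [:\<theta> i, -1:])
            * (\<Prod>j\<in>{1..n} - {l} - {i}. (V j)^3))"
          by (simp add: U_def V_def)
        then show ?thesis using k by (simp only: fps_X_power_mult_nth) simp
      qed
      moreover have "((\<Prod>j\<in>{1..n}. (V j)^2 + fps_const (\<theta> j)) - U i) $ k = 0"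
        unfolding U_def TV V_def by (rule hypoxg_expansion[OF pos inj i k])
      ultimately have "fps_of_poly (pcompose D [:\<theta> i, -1:]) $ k = 0"
        unfolding D by (simp add: fps_sum_nth)
      then show "coeff (pcompose D [:\<theta> i, -1:]) k = 0" by simp
    qed
    show "coprime (P i ^ 3) (P j ^ 3)" if "i \<in> {1..n}" "j \<in> {1..n}" "i \<noteq> j" for i j
    proof -
      have "\<theta> i - \<theta> j \<noteq> 0" using inj_onD[OF inj, of i j] that by auto
      moreover have "c dvd [:\<theta> i - \<theta> j:]" if "c dvd P i" "c dvd P j" for c
        using dvd_diff[OF that] by (simp add: P_def)
      ultimately have "coprime (P i) (P j)"
        by (intro coprimeI) (meson dvd_trans is_unit_triv)
      then show ?thesis by simp
    qed
    have "degree (\<Prod>j\<in>{1..n}. (P j)^3) = 3 * n"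
      by (subst degree_prod_eq_sum_degree) (auto simp: degP, simp add: P_def)
    moreover have "degree (\<Prod>j\<in>{1..n}. (P j)^2 + [:\<theta> j:]) < 3 * n"
    proof -
      have "degree ((P j)^2 + [:\<theta> j:]) \<le> 2" for j
        by (intro degree_add_le) (simp_all add: degP)
      then have "(\<Sum>j\<in>{1..n}. degree ((P j)^2 + [:\<theta> j:])) \<le> (\<Sum>j\<in>{1..n}. 2)"
        by (intro sum_mono) auto
      with degree_prod_sum_le[of "{1..n}" "\<lambda>j. (P j)^2 + [:\<theta> j:]"] n
      show ?thesis by (simp add: comp_def)
    qed
    moreover have "degree (\<Sum>i\<in>{1..n}. T i * (\<Prod>j\<in>{1..n} - {i}. (P j)^3)) < 3 * n"
    proof (rule degree_sum_less)
      fix i assume i: "i \<in> {1..n}"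
      have "degree (T i) \<le> 2"
        unfolding T_def using degP[of i 1] degP[of i 2] by (intro degree_add_le order.trans[OF degree_mult_le]) auto
      moreover have "degree (\<Prod>j\<in>{1..n} - {i}. (P j)^3) \<le> 3 * (n - 1)"
        using degree_prod_sum_le[of "{1..n} - {i}" "\<lambda>j. (P j)^3"] i by (simp add: comp_def degP)
      ultimately show "degree (T i * (\<Prod>j\<in>{1..n} - {i}. (P j)^3)) < 3 * n"
        using degree_mult_le[of "T i" "\<Prod>j\<in>{1..n} - {i}. (P j)^3"] n by linarith
    qed (use n in simp)
    ultimately show "degree D < degree (\<Prod>j\<in>{1..n}. (P j)^3)"
      unfolding D_def by (auto intro: degree_diff_less)
  qed
  then show ?thesis by (simp add: D_def T_def)
qed

lemma hypoxg_partial_fractions: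
  fixes \<theta> :: "nat \<Rightarrow> real"
  assumes "n \<ge> 1" and "\<And>j. j \<in> {1..n} \<Longrightarrow> \<theta> j > 0" and "inj_on \<theta> {1..n}"
  defines "P \<equiv> \<lambda>j. fps_const (\<theta> j) - fps_X"
  shows "(\<Prod>j\<in>{1..n}. (P j)^2 + fps_const (\<theta> j)) =
    (\<Sum>i\<in>{1..n}. (fps_const (hypoxg_A n \<theta> i 1) + fps_const (hypoxg_A n \<theta> i 2) * P i
        + fps_const (hypoxg_A n \<theta> i 3) * (P i)^2) * (\<Prod>j\<in>{1..n} - {i}. (P j)^3))"
proof -
  have P: "fps_of_poly [:\<theta> j, -1:] = P j" for j
    by (simp add: P_def fps_of_poly_pCons flip: fps_const_neg)
  show ?thesis
    using arg_cong[OF hypoxg_partial_fractions_poly[OF assms(1-3)], of fps_of_poly]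
    by (simp only: fps_of_poly_sum fps_of_poly_prod fps_of_poly_add fps_of_poly_mult
        fps_of_poly_power fps_of_poly_const P)
qed

theorem theorem2p7:
  fixes M :: "'a measure" and S :: "'a \<Rightarrow> real"
    and N :: "nat \<Rightarrow> nat \<Rightarrow> 'b measure" and Y :: "nat \<Rightarrow> nat \<Rightarrow> 'b \<Rightarrow> real"
    and \<theta> :: "nat \<Rightarrow> real" and n m :: nat
  assumes "n \<ge> 1"
    and "\<And>j. j \<in> {1..n} \<Longrightarrow> \<theta> j > 0"
    and "inj_on \<theta> {1..n}"
    and "HypoXG M n \<theta> S"
    and "\<And>i k. i \<in> {1..n} \<Longrightarrow> k \<in> {1..3} \<Longrightarrow> Erl (N i k) (4 - k) (\<theta> i) (Y i k)"
    and "m \<ge> 1"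
  shows "integrable M (\<lambda>\<omega>. S \<omega> ^ m) \<and>
    (\<forall>i\<in>{1..n}. \<forall>k\<in>{1..3}. integrable (N i k) (\<lambda>\<omega>. Y i k \<omega> ^ m)) \<and>
    integral\<^sup>L M (\<lambda>\<omega>. S \<omega> ^ m) =
      (\<Sum>i=1..n. \<Sum>k=1..3. hypoxg_R n \<theta> i k * integral\<^sup>L (N i k) (\<lambda>\<omega>. Y i k \<omega> ^ m))"
proof -
  note pos = assms(2)
  from assms(4) obtain X where prob: "prob_space M"
    and ind: "prob_space.indep_vars M (\<lambda>_. borel) X {1..n}"
    and XG: "\<And>j. j \<in> {1..n} \<Longrightarrow> XG M (\<theta> j) (X j)"
    and S: "\<And>\<omega>. \<omega> \<in> space M \<Longrightarrow> S \<omega> = (\<Sum>j=1..n. X j \<omega>)"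
    unfolding HypoXG_def by blast
  interpret prob_space M by (rule prob)
  have sum: "integrable M (\<lambda>\<omega>. (\<Sum>j=1..n. X j \<omega>) ^ m)"
      "moment_fps M (\<lambda>\<omega>. \<Sum>j=1..n. X j \<omega>) = (\<Prod>j=1..n. moment_fps M (X j))"
    using indep_vars_sum_moment[OF _ ind] XG_moment(1)[OF XG] by auto
  define P where "P j = fps_const (\<theta> j) - fps_X" for j
  define C where "C = (\<Prod>l=1..n. (\<theta> l)^2 / (1 + \<theta> l))"
  define Q where "Q = (\<Prod>j=1..n. (P j)^3)"
  define E where "E i k = erlang_fps (3 - k) (\<theta> i)" for i k
  define H where "H = (\<Sum>i=1..n. \<Sum>k=1..3. fps_const (hypoxg_R n \<theta> i k) * E i k)"
  have k3: "{1..3} = {1, 2, 3::nat}" by auto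

  have H_term: "(\<Sum>k=1..3. fps_const (hypoxg_R n \<theta> i k) * E i k) * (P i)^3 =
      fps_const C * (fps_const (hypoxg_A n \<theta> i 1) + fps_const (hypoxg_A n \<theta> i 2) * P i
        + fps_const (hypoxg_A n \<theta> i 3) * (P i)^2)" if i: "i \<in> {1..n}" for i
  proof -
    have EP: "E i k * (P i)^3 = fps_const (\<theta> i ^ (4 - k)) * P i ^ (k - 1)" if "k \<in> {1..3}" for k
    proof -
      have k: "Suc (3 - k) + (k - 1) = 3" "Suc (3 - k) = 4 - k" using that by auto
      have "E i k * P i ^ 3 = E i k * P i ^ Suc (3 - k) * P i ^ (k - 1)"
        unfolding mult.assoc power_add[symmetric] k(1) ..
      also have "E i k * P i ^ Suc (3 - k) = fps_const (\<theta> i ^ Suc (3 - k))"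
        unfolding E_def P_def by (rule erlang_fps_mult_power[OF pos[OF i]])
      finally show ?thesis unfolding k(2) .
    qed
    have "fps_const (hypoxg_R n \<theta> i k) * E i k * (P i)^3 =
        fps_const C * (fps_const (hypoxg_A n \<theta> i k) * P i ^ (k - 1))" if "k \<in> {1..3}" for k
    proof -
      have "hypoxg_R n \<theta> i k * \<theta> i ^ (4 - k) = C * hypoxg_A n \<theta> i k"
        using pos[OF i] by (simp add: hypoxg_R_def C_def)
      then show ?thesis
        unfolding mult.assoc EP[OF that] by (simp flip: mult.assoc)
    qed
    then have "(\<Sum>k=1..3. fps_const (hypoxg_R n \<theta> i k) * E i k * (P i)^3) =
        (\<Sum>k=1..3. fps_const C * (fps_const (hypoxg_A n \<theta> i k) * P i ^ (k - 1)))"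
      by (intro sum.cong) auto
    then show ?thesis
      unfolding sum_distrib_right[symmetric] sum_distrib_left[symmetric] k3
      by (simp add: add.assoc)
  qed

  have "(\<Prod>j=1..n. moment_fps M (X j)) * Q =
      (\<Prod>j=1..n. fps_const ((\<theta> j)^2 / (1 + \<theta> j)) * ((P j)^2 + fps_const (\<theta> j)))"
    unfolding Q_def prod.distrib[symmetric] P_def using XG_moment(2)[OF XG] by (intro prod.cong) auto
  also have "\<dots> = fps_const C * (\<Prod>j=1..n. (P j)^2 + fps_const (\<theta> j))"
    unfolding prod.distrib C_def fps_const_prod ..
  also have "\<dots> = (\<Sum>i=1..n. fps_const C * (fps_const (hypoxg_A n \<theta> i 1)
        + fps_const (hypoxg_A n \<theta> i 2) * P i + fps_const (hypoxg_A n \<theta> i 3) * (P i)^2)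
        * (\<Prod>j\<in>{1..n} - {i}. (P j)^3))"
    using hypoxg_partial_fractions[OF assms(1) pos assms(3)] unfolding P_def
    by (simp only: sum_distrib_left mult.assoc)
  also have "\<dots> = H * Q"
    unfolding H_def
  proof (subst sum_distrib_right, rule sum.cong)
    fix i assume i: "i \<in> {1..n}"
    have "Q = (P i)^3 * (\<Prod>j\<in>{1..n} - {i}. (P j)^3)"
      unfolding Q_def using i by (intro prod.remove) auto
    then show "fps_const C * (fps_const (hypoxg_A n \<theta> i 1)
        + fps_const (hypoxg_A n \<theta> i 2) * P i + fps_const (hypoxg_A n \<theta> i 3) * (P i)^2)
        * (\<Prod>j\<in>{1..n} - {i}. (P j)^3) =
        (\<Sum>k=1..3. fps_const (hypoxg_R n \<theta> i k) * E i k) * Q"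
      unfolding H_term[OF i, symmetric] by (simp only: mult.assoc)
  qed simp
  finally have "(\<Prod>j=1..n. moment_fps M (X j)) * Q = H * Q" .
  moreover have "Q \<noteq> 0"
  proof -
    have "P j $ 1 = -1" for j by (simp add: P_def)
    then have "P j \<noteq> 0" for j by (metis fps_zero_nth zero_neq_neg_one)
    then show ?thesis by (simp add: Q_def)
  qed
  ultimately have F: "moment_fps M (\<lambda>\<omega>. \<Sum>j=1..n. X j \<omega>) = H"
    unfolding sum(2) by simp

  have EY: "E i k $ m = integral\<^sup>L (N i k) (\<lambda>\<omega>. Y i k \<omega> ^ m) / fact m"
    if "i \<in> {1..n}" "k \<in> {1..3}" for i k
  proof -
    have "4 - k - 1 = 3 - k" by simp
    then have "E i k = moment_fps (N i k) (Y i k)"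
      using Erl_moment(2)[OF assms(5)[OF that]] by (simp add: E_def)
    then show ?thesis by simp
  qed
  have "integral\<^sup>L M (\<lambda>\<omega>. S \<omega> ^ m) = moment_fps M (\<lambda>\<omega>. \<Sum>j=1..n. X j \<omega>) $ m * fact m"
    using S by (simp cong: Bochner_Integration.integral_cong)
  also have "\<dots> = (\<Sum>i=1..n. \<Sum>k=1..3. hypoxg_R n \<theta> i k * (E i k $ m * fact m))"
    unfolding F H_def by (simp only: fps_sum_nth fps_mult_left_const_nth sum_distrib_right mult.assoc)
  also have "\<dots> = (\<Sum>i=1..n. \<Sum>k=1..3. hypoxg_R n \<theta> i k * integral\<^sup>L (N i k) (\<lambda>\<omega>. Y i k \<omega> ^ m))"
    using EY by (intro sum.cong) auto
  finally have "integral\<^sup>L M (\<lambda>\<omega>. S \<omega> ^ m) =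
      (\<Sum>i=1..n. \<Sum>k=1..3. hypoxg_R n \<theta> i k * integral\<^sup>L (N i k) (\<lambda>\<omega>. Y i k \<omega> ^ m))" .
  moreover have "integrable M (\<lambda>\<omega>. S \<omega> ^ m)"
    using sum(1) S by (simp cong: Bochner_Integration.integrable_cong)
  moreover have "integrable (N i k) (\<lambda>\<omega>. Y i k \<omega> ^ m)" if "i \<in> {1..n}" "k \<in> {1..3}" for i k
    by (rule Erl_moment(1)[OF assms(5)[OF that]])
  ultimately show ?thesis by blast
qed

end
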